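(* Let $G$ be a finite group. Then the poset $C(G)$ of cyclic subgroups of $G$ possesses a breaking point if and only if $G$ is either a cyclic $p$-group of order at least $p^2$ for some prime $p$, or a generalized quaternion $2$-group $Q_{2^n}$ for some $n\geq 3$.
   Context: For a finite group $G$, $C(G)$ denotes the set of cyclic subgroups of $G$, partially ordered by inclusion. A breaking point of $C(G)$ is a subgroup $H\in C(G)$ with $H\neq 1$ and $H\neq G$ such that for every $X\in C(G)$ we have $X\leq H$ or $H\leq X$. For $n\geq 3$, the generalized quaternion $2$-group is $Q_{2^n}=\langle a,b \mid a^{2^{n-2}}=b^2,\ a^{2^{n-1}}=1,\ b^{-1}ab=a^{-1}\rangle$, of order $2^n$. *)

theory Defs
  imports "HOL-Algebra.Algebra" "HOL-Computational_Algebra.Primes"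
begin

definition cyclic_subgroups :: "('a, 'b) monoid_scheme \<Rightarrow> 'a set set" where
  "cyclic_subgroups G = {generate G {x} | x. x \<in> carrier G}"

definition breaking_point :: "('a, 'b) monoid_scheme \<Rightarrow> 'a set \<Rightarrow> bool" where
  "breaking_point G H \<longleftrightarrow>
     H \<in> cyclic_subgroups G \<and> H \<noteq> {\<one>\<^bsub>G\<^esub>} \<and> H \<noteq> carrier G \<and>
     (\<forall>K \<in> cyclic_subgroups G. K \<subseteq> H \<or> H \<subseteq> K)"

text \<open>Concrete model of the generalized quaternion group Q_{2^n}
  = <a,b | a^(2^(n-2)) = b^2, a^(2^(n-1)) = 1, b^-1 a b = a^-1>.
  The pair (i, e) represents a^i b^e with 0 <= i < 2^(n-1), e in {0,1}
  (e = True meaning exponent 1). Using b a^j = a^(-j) b and b^2 = a^(2^(n-2)).\<close>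
definition quaternion_mult :: "nat \<Rightarrow> int \<times> bool \<Rightarrow> int \<times> bool \<Rightarrow> int \<times> bool" where
  "quaternion_mult n x y =
     (let i = fst x; e = snd x; j = fst y; f = snd y; N = (2::int) ^ (n - 1) in
      if \<not> e then ((i + j) mod N, f)
      else if \<not> f then ((i - j) mod N, True)
      else ((i - j + 2 ^ (n - 2)) mod N, False))"

definition quaternion_group :: "nat \<Rightarrow> (int \<times> bool) monoid" where
  "quaternion_group n =
     \<lparr> carrier = {0..<(2::int) ^ (n - 1)} \<times> (UNIV :: bool set),
       monoid.mult = quaternion_mult n,
       one = ((0::int), False) \<rparr>"

end

theory Submission
  imports Defs "HOL-Number_Theory.Residues"
begin

text \<open>
  A breaking point \<open>H\<close> contains every element of prime order. If \<open>G\<close> were not a \<open>p\<close>-group, then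
  every prime divisor of the order of \<open>G\<close> would divide that of \<open>H\<close>, so no element of prime power order
  could generate a group containing \<open>H\<close>; hence \<open>H\<close> would contain all Sylow subgroups and equal \<open>G\<close>.
  So \<open>G\<close> is a \<open>p\<close>-group, and a cyclic subgroup \<open>A = \<langle>a\<rangle>\<close> of maximal order properly contains \<open>H\<close>,
  hence all elements of order \<open>p\<close>.

  If \<open>A \<noteq> G\<close>, normalizers grow, so there is \<open>x \<notin> A\<close> normalizing \<open>A\<close> with \<open>x\<^sup>p = a\<^sup>j\<close> and
  \<open>x a x\<inverse> = a\<^sup>r\<close>. Then \<open>(a\<^sup>i x)\<^sup>p\<close> is \<open>a\<close> to the power \<open>i (1 + r + \<dots> + r\<^bsup>p-1\<^esup>) + j\<close>, which is
  never 1, as \<open>A\<close> contains all elements of order \<open>p\<close>.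
  For odd \<open>p\<close> a suitable \<open>i\<close> would make it 1; for \<open>p = 2\<close> this is avoided only if \<open>x\<close> inverts \<open>a\<close>
  and \<open>x\<^sup>2\<close> is the involution of \<open>A\<close>. As \<open>-1\<close> is not a square modulo 4, the normalizer of \<open>A\<close> is then
  generalized quaternion with \<open>A\<close> of index 2, and it is all of \<open>G\<close>.
\<close>

section \<open>Congruences and normalizers in p-groups\<close>

text \<open>Every term of the binomial expansion beyond the linear one contains
  \<open>p^2\<close>.\<close>

lemma power_cong_linear:
  fixes p t l :: nat
  shows "[(1 + p * t) ^ l = 1 + l * (p * t)] (mod p\<^sup>2)"
proof (induction l)
  case (Suc l)
  have "[(1 + p * t) ^ Suc l = (1 + p * t) * (1 + l * (p * t))] (mod p\<^sup>2)"
    using cong_scalar_left[OF Suc.IH] by (simp only: power_Suc)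
  also have "(1 + p * t) * (1 + l * (p * t)) = 1 + Suc l * (p * t) + p\<^sup>2 * (l * t * t)"
    by (simp add: algebra_simps power2_eq_square)
  also have "[1 + Suc l * (p * t) + p\<^sup>2 * (l * t * t) = 1 + Suc l * (p * t)] (mod p\<^sup>2)"
    by (simp add: cong_def)
  finally show ?case .
qed simp

text \<open>With \<open>r = 1 + p * t\<close> the sum is, modulo \<open>p^2\<close>,
  \<open>p\<close> plus \<open>p * t\<close> times 0 + ... + (p-1). For odd \<open>p\<close> this
  triangular number is itself a multiple of \<open>p\<close>, so exactly one factor \<open>p\<close>
  splits off.\<close>

lemma sum_power_odd_prime:
  fixes p r :: nat
  assumes p: "Factorial_Ring.prime p" "odd p" and r: "[r = 1] (mod p)"
  obtains u where "(\<Sum>l<p. r ^ l) = p * u" "coprime u p"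
proof -
  have p1: "p > 1" using p prime_gt_1_nat by blast
  have "r \<noteq> 0"
  proof
    assume "r = 0"
    then show False using r p1 by (simp add: cong_def)
  qed
  then have "p dvd r - 1"
    using r p1 by (metis One_nat_def Suc_leI cong_altdef_nat neq0_conv)
  then obtain t where "r - 1 = p * t" by blast
  then have t: "r = 1 + p * t" using \<open>r \<noteq> 0\<close> by simp
  obtain q where q: "p = 2 * q + 1" using p(2) oddE by blast
  have gauss: "(\<Sum>l<p. l) = p * q"
    unfolding q by (induction q) (auto simp: algebra_simps)
  have "[(\<Sum>l<p. r ^ l) = (\<Sum>l<p. 1 + l * (p * t))] (mod p\<^sup>2)"
    unfolding t by (intro cong_sum power_cong_linear)
  also have "(\<Sum>l<p. 1 + l * (p * t)) = p + (\<Sum>l<p. l) * (p * t)"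
    by (simp only: sum.distrib sum_distrib_right sum_constant card_lessThan) simp
  also have "\<dots> = p + p\<^sup>2 * (q * t)"
    by (simp add: gauss power2_eq_square)
  also have "[\<dots> = p] (mod p\<^sup>2)" by (simp add: cong_def)
  finally have S: "[(\<Sum>l<p. r ^ l) = p] (mod p\<^sup>2)" .
  then have "[(\<Sum>l<p. r ^ l) = p] (mod p)"
    by (metis cong_dvd_modulus_nat dvd_triv_left power2_eq_square)
  then have "p dvd (\<Sum>l<p. r ^ l)" by (simp add: cong_dvd_iff)
  then obtain u where u: "(\<Sum>l<p. r ^ l) = p * u" by blast
  have "[p * u = p * 1] (mod p * p)" using S u by (simp add: power2_eq_square)
  then have "[u = 1] (mod p)" using p1 by (simp add: cong_def mult_mod_right[symmetric])
  then have "coprime u p" using cong_imp_coprime cong_sym coprime_1_left by blast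
  with u that show thesis by blast
qed

lemma cong_solve_affine_nat:
  fixes p u j N :: nat
  assumes "coprime u N" "p dvd j" "N > 0"
  obtains i where "N dvd i * (p * u) + j"
proof -
  obtain x where x: "[u * x = 1] (mod N)"
    using cong_solve_coprime_nat assms(1) by (metis One_nat_def)
  obtain j' where j': "j = p * j'" using assms(2) by blast
  \<comment> \<open>\<open>N - 1\<close> stands for -1 modulo \<open>N\<close>, which keeps the
    solution \<open>- x * j'\<close> in the natural numbers.\<close>
  have "[(x * j' * (N - 1)) * (p * u) + j = (u * x) * (j * (N - 1)) + j] (mod N)"
    by (simp add: j' mult_ac)
  also have "[(u * x) * (j * (N - 1)) + j = 1 * (j * (N - 1)) + j] (mod N)"
    by (intro cong_add cong_mult x cong_refl)
  also have "1 * (j * (N - 1)) + j = N * j"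
    using assms(3) by (simp add: algebra_simps flip: mult_Suc_right)
  finally have "N dvd (x * j' * (N - 1)) * (p * u) + j"
    by (simp add: cong_dvd_iff)
  then show thesis using that by blast
qed

text \<open>The 2-adic valuation k of \<open>s\<close> is below \<open>m\<close>, so scaling by
  \<open>2 ^ (m - 1 - k)\<close> turns \<open>s\<close> into an odd multiple of
  \<open>2 ^ (m - 1)\<close>. Adding \<open>2 ^ (m - 1)\<close> makes the multiple even.\<close>

lemma dvd_half_solution:
  fixes s m :: nat
  assumes "\<not> 2 ^ m dvd s"
  obtains i where "2 ^ m dvd i * s + 2 ^ (m - 1)"
proof -
  have s0: "s \<noteq> 0" using assms by (metis dvd_0_right)
  obtain u where u: "s = 2 ^ multiplicity 2 s * u" "odd u"
    using multiplicity_decompose'[of s 2] s0 by auto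
  define k where "k = multiplicity 2 s"
  have ku: "s = 2 ^ k * u" "odd u" using u unfolding k_def by auto
  have "k < m" using assms ku by (meson dvd_triv_left le_imp_power_dvd dvd_trans not_less)
  obtain v where v: "u = 2 * v + 1" using ku oddE by blast
  have "2 ^ (m - 1 - k) * s + 2 ^ (m - 1) = 2 ^ m * (v + 1)"
  proof -
    have "2 ^ (m - 1 - k) * s = 2 ^ (m - 1) * u"
      using \<open>k < m\<close> ku by (simp flip: power_add mult.assoc)
    moreover have "(2::nat) ^ m = 2 * 2 ^ (m - 1)" using \<open>k < m\<close> by (cases m) auto
    ultimately show ?thesis by (simp add: v algebra_simps)
  qed
  then show thesis using that by (metis dvd_triv_left)
qed

text \<open>Squares are 0 or 1 modulo 4. This later prevents the square of an element normalizing
  \<langle>a\<rangle> from inverting \<open>a\<close>.\<close>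

lemma not_four_dvd_Suc_square: "\<not> 4 dvd 1 + s\<^sup>2" for s :: nat
proof (cases "even s")
  case True
  then show ?thesis by (auto simp: dvd_def) presburger
next
  case False
  then obtain v where "s = 2 * v + 1" by (elim oddE)
  then have "1 + s\<^sup>2 = 4 * (v * v + v) + 2" by (simp add: power2_eq_square algebra_simps)
  then show ?thesis by presburger
qed

section \<open>Actions of p-groups and growth of normalizers\<close>

lemma group_actionI:
  fixes G (structure)
  assumes "group G"
    and closed: "\<And>g x. g \<in> carrier G \<Longrightarrow> x \<in> E \<Longrightarrow> f g x \<in> E"
    and one: "\<And>x. x \<in> E \<Longrightarrow> f \<one> x = x"
    and mult: "\<And>g h x. g \<in> carrier G \<Longrightarrow> h \<in> carrier G \<Longrightarrow> x \<in> E \<Longrightarrow> f (g \<otimes> h) x = f g (f h x)"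
  shows "group_action G E (\<lambda>g. restrict (f g) E)"
proof -
  interpret group G by fact
  have inv1: "f (inv g) (f g x) = x" "f g (f (inv g) x) = x" if "g \<in> carrier G" "x \<in> E" for g x
    using mult[of "inv g" g x] mult[of g "inv g" x] that by (simp_all add: one)
  have bij: "restrict (f g) E \<in> Bij E" if g: "g \<in> carrier G" for g
  proof -
    \<comment> \<open>Acting by \<open>inv g\<close> undoes acting by \<open>g\<close>. The
      restriction to \<open>E\<close> is taken afterwards because \<open>Bij E\<close> admits only
      functions that are \<open>undefined\<close> outside \<open>E\<close>.\<close>
    have "bij_betw (f g) E E"
      by (rule bij_betw_byWitness[where f' = "f (inv g)"]) (use g in \<open>auto simp: inv1 closed\<close>)
    then have "bij_betw (restrict (f g) E) E E"
      by (simp cong: bij_betw_cong)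
    then show ?thesis by (simp add: Bij_def)
  qed
  show ?thesis
    unfolding group_action_def group_hom_def group_hom_axioms_def hom_def
    using \<open>group G\<close> group_BijGroup[of E] bij
    by (auto simp: BijGroup_def compose_def restrict_def closed mult fun_eq_iff)
qed

text \<open>Orbit sizes divide \<open>p ^ n\<close>, so every orbit with more than one point has
  size divisible by \<open>p\<close>. If \<open>e\<close> were the only fixed point,
  \<open>card E\<close> would be 1 modulo \<open>p\<close>.\<close>

lemma (in group_action) second_fixed_point:
  assumes p: "Factorial_Ring.prime p" and order: "order G = p ^ n"
    and E: "finite E" "p dvd card E" and e: "e \<in> E" "\<And>g. g \<in> carrier G \<Longrightarrow> \<phi> g e = e"
  obtains e' where "e' \<in> E" "e' \<noteq> e" "\<And>g. g \<in> carrier G \<Longrightarrow> \<phi> g e' = e'"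
proof (rule ccontr)
  assume "\<not> thesis"
  with that have no: "\<exists>g\<in>carrier G. \<phi> g e' \<noteq> e'" if "e' \<in> E" "e' \<noteq> e" for e'
    using \<open>e' \<in> E\<close> \<open>e' \<noteq> e\<close> by blast
  interpret group_hom G "BijGroup E" \<phi> by (rule group_hom)
  have orb_e: "orbit G \<phi> e = {e}"
    using e(2) G.one_closed by (force simp: orbit_def)
  have dvd: "p dvd card orb" if orb: "orb \<in> orbits G E \<phi>" "orb \<noteq> {e}" for orb
  proof -
    obtain x where x: "x \<in> E" "orb = orbit G \<phi> x" using orb by (auto simp: orbits_def)
    have "card orb dvd p ^ n"
      using orbit_stabilizer_theorem[OF x(1)] order x(2) by (metis dvd_triv_left)
    then obtain k where k: "card orb = p ^ k" using p divides_primepow_nat by blast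
    have "x \<noteq> e" using x orb orb_e by blast
    then obtain g where g: "g \<in> carrier G" "\<phi> g x \<noteq> x" using no x(1) by blast
    have "{x, \<phi> g x} \<subseteq> orb"
      using g x orbit_refl[OF x(1)] by (auto simp: orbit_def)
    then have "k \<noteq> 0" using k g(2) card_seteq[of "{x, \<phi> g x}"]
      by (metis card_1_singletonE insert_subset power_0 singletonD)
    then show ?thesis using k by simp
  qed
  have "finite (orbits G E \<phi>)" using E(1) by (simp add: orbits_def setcompr_eq_image)
  moreover have "{e} \<in> orbits G E \<phi>" using orb_e e(1) by (auto simp: orbits_def)
  moreover have "card E = (\<Sum>orb\<in>orbits G E \<phi>. card orb)"
    using disjoint_sum[OF E(1), of "\<lambda>_. 1::nat"] by simp
  ultimately have "card E = 1 + (\<Sum>orb\<in>orbits G E \<phi> - {{e}}. card orb)"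
    by (simp add: sum.remove)
  moreover have "p dvd (\<Sum>orb\<in>orbits G E \<phi> - {{e}}. card orb)"
    by (intro dvd_sum dvd) auto
  ultimately have "p dvd 1" using E(2) by (metis dvd_add_left_iff)
  then show False using p by simp
qed

text \<open>\<open>H\<close> acts by translation on its right cosets, whose number is a positive
  power of \<open>p\<close>. The coset \<open>H\<close> is fixed, hence so is another coset
  \<open>H #> x\<close>, and this means that \<open>x\<close> normalizes \<open>H\<close>.\<close>

lemma (in group) normalizer_grows:
  assumes fin: "finite (carrier G)" and p: "Factorial_Ring.prime p" "order G = p ^ n"
    and H: "subgroup H G" "H \<noteq> carrier G"
  obtains x where "x \<in> carrier G" "x \<notin> H" "\<And>a. a \<in> H \<Longrightarrow> x \<otimes> a \<otimes> inv x \<in> H"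
proof -
  interpret H: subgroup H G by fact
  let ?H = "G\<lparr>carrier := H\<rparr>"
  \<comment> \<open>Translating by \<open>inv g\<close> instead of \<open>g\<close> turns the right
    action into a left one.\<close>
  interpret act: group_action ?H "rcosets H" "\<lambda>g. restrict (\<lambda>C. C #> inv g) (rcosets H)"
  proof (rule group_actionI)
    show "group ?H" using H.subgroup_is_group[OF is_group] .
    show "C #> inv g \<in> rcosets H" if "g \<in> carrier ?H" "C \<in> rcosets H" for g C
      using that H.mem_carrier by (auto simp: RCOSETS_def coset_mult_assoc H.subset)
    show "C #> inv \<one>\<^bsub>?H\<^esub> = C" if "C \<in> rcosets H" for C
      using that H.rcosets_carrier[OF is_group] by (simp add: coset_mult_one)
    show "C #> inv (g \<otimes>\<^bsub>?H\<^esub> h) = C #> inv h #> inv g"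
      if "g \<in> carrier ?H" "h \<in> carrier ?H" "C \<in> rcosets H" for g h C
      using that H.rcosets_carrier[OF is_group] by (simp add: coset_mult_assoc inv_mult_group H.mem_carrier)
  qed
  have card: "card (rcosets H) * card H = p ^ n" using lagrange[OF H(1)] p(2) by simp
  obtain k where k: "card H = p ^ k" using card divides_primepow_nat p(1) by (metis dvd_triv_right)
  obtain l where l: "card (rcosets H) = p ^ l" using card divides_primepow_nat p(1) by (metis dvd_triv_left)
  have "l \<noteq> 0"
  proof
    assume "l = 0"
    then have "card H = card (carrier G)" using card l p(2) by (simp add: order_def)
    then show False using card_subset_eq[OF fin H.subset] H(2) by blast
  qed
  have "H #> \<one> = H" by (simp add: H.subset coset_mult_one)
  then have H_in: "H \<in> rcosets H" using rcosetsI[OF H.subset one_closed] by simp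
  have "order ?H = p ^ k" using k by (simp add: order_def)
  moreover have "finite (rcosets H)" using fin by (simp add: RCOSETS_def)
  moreover have "p dvd card (rcosets H)" using l \<open>l \<noteq> 0\<close> by simp
  ultimately obtain C where C: "C \<in> rcosets H" "C \<noteq> H"
      "\<And>g. g \<in> carrier ?H \<Longrightarrow> restrict (\<lambda>C. C #> inv g) (rcosets H) C = C"
    using act.second_fixed_point[OF p(1), of k H] H_in H.rcos_const[OF is_group] by auto
  obtain x where x: "x \<in> carrier G" "C = H #> x" using C(1) by (auto simp: RCOSETS_def)
  show thesis
  proof
    show "x \<in> carrier G" by fact
    show "x \<notin> H" using C(2) x H.rcos_const[OF is_group] by blast
    show "x \<otimes> a \<otimes> inv x \<in> H" if a: "a \<in> H" for a
    proof -
      have "H #> x #> a = H #> x" using C(3)[of "inv a"] C(1) a x by simp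
      then have "x \<otimes> a \<in> H #> x"
        using rcos_self[OF _ H(1), of "x \<otimes> a"] a x by (simp add: coset_mult_assoc H.subset)
      then obtain h where "h \<in> H" "x \<otimes> a = h \<otimes> x" by (auto simp: r_coset_def)
      then show ?thesis using x a by (simp add: m_assoc)
    qed
  qed
qed

section \<open>Maximal cyclic subgroups\<close>

lemma (in group) pow_twisted:
  fixes r k :: nat
  assumes x: "x \<in> carrier G" "a \<in> carrier G" "x \<otimes> a = a [^] r \<otimes> x"
  shows "x \<otimes> a [^] k = a [^] (r * k) \<otimes> x"
proof (induction k)
  case (Suc k)
  have "x \<otimes> a [^] Suc k = (x \<otimes> a [^] k) \<otimes> a"
    using x by (simp add: m_assoc)
  also have "\<dots> = a [^] (r * k) \<otimes> (x \<otimes> a)"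
    unfolding Suc.IH using x by (simp add: m_assoc)
  also have "\<dots> = a [^] (r * Suc k) \<otimes> x"
    using x by (simp add: nat_pow_mult add.commute flip: m_assoc)
  finally show ?case .
qed (use x in simp)

lemma (in group) pow_twisted_left:
  fixes r l :: nat
  assumes x: "x \<in> carrier G" "a \<in> carrier G" "x \<otimes> a = a [^] r \<otimes> x"
  shows "x [^] l \<otimes> a = a [^] (r ^ l) \<otimes> x [^] l"
proof (induction l)
  case (Suc l)
  have "x [^] Suc l \<otimes> a = x [^] l \<otimes> (x \<otimes> a)"
    using x by (simp add: m_assoc)
  also have "\<dots> = (x [^] l \<otimes> a [^] r) \<otimes> x"
    using x by (simp add: m_assoc)
  \<comment> \<open>The induction hypothesis is itself a twist relation, for \<open>x [^] l\<close>
    with exponent \<open>r ^ l\<close>, so \<open>pow_twisted\<close> applies to it.\<close>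
  also have "\<dots> = a [^] (r ^ Suc l) \<otimes> x [^] Suc l"
    using x by (simp add: pow_twisted[OF _ _ Suc.IH] m_assoc mult.commute)
  finally show ?case .
qed (use x in simp)

lemma (in group) twisted_mult:
  fixes r s :: nat
  assumes x: "x \<in> carrier G" "x \<otimes> a = a [^] r \<otimes> x"
    and y: "y \<in> carrier G" "y \<otimes> a = a [^] s \<otimes> y" and a: "a \<in> carrier G"
  shows "(x \<otimes> y) \<otimes> a = a [^] (r * s) \<otimes> (x \<otimes> y)"
proof -
  have "(x \<otimes> y) \<otimes> a = (x \<otimes> a [^] s) \<otimes> y" using x(1) y a by (simp add: m_assoc)
  then show ?thesis using x(1) y(1) a by (simp add: pow_twisted[OF x(1) a x(2)] m_assoc)
qed

text \<open>Collecting the powers of \<open>a\<close> on the left moves one factor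
  \<open>a [^] i\<close> past each \<open>x [^] l\<close>, which multiplies its exponent by
  \<open>r ^ l\<close>; hence the geometric sum.\<close>

lemma (in group) pow_twisted_mult:
  fixes r i k :: nat
  assumes x: "x \<in> carrier G" "a \<in> carrier G" "x \<otimes> a = a [^] r \<otimes> x"
  shows "(a [^] i \<otimes> x) [^] k = a [^] (i * (\<Sum>l<k. r ^ l)) \<otimes> x [^] k"
proof (induction k)
  case (Suc k)
  have S: "i * (\<Sum>l<Suc k. r ^ l) = i * (\<Sum>l<k. r ^ l) + r ^ k * i"
    by (simp add: algebra_simps)
  have "(a [^] i \<otimes> x) [^] Suc k = a [^] (i * (\<Sum>l<k. r ^ l)) \<otimes> (x [^] k \<otimes> a [^] i) \<otimes> x"
    using x by (simp add: Suc.IH m_assoc)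
  also have "x [^] k \<otimes> a [^] i = a [^] (r ^ k * i) \<otimes> x [^] k"
    using x by (intro pow_twisted pow_twisted_left) auto
  finally show ?case
    unfolding S using x by (simp add: m_assoc nat_pow_mult[symmetric])
qed (use x in simp)

lemma (in group) inv_mult_cancel:
  assumes "x \<in> carrier G" "y \<in> carrier G"
  shows "inv x \<otimes> (x \<otimes> y) = y" "x \<otimes> (inv x \<otimes> y) = y"
  using assms by (simp_all flip: m_assoc)

lemma (in group) conj_hom: "b \<in> carrier G \<Longrightarrow> (\<lambda>x. b \<otimes> x \<otimes> inv b) \<in> hom G G"
  by (rule homI) (simp_all add: m_assoc inv_mult_cancel)

text \<open>This is all that is kept of a breaking point \<open>H\<close>. The bound
  \<open>m \<ge> 2\<close> reflects that \<open>H\<close> is nontrivial and properly contained in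
  \<langle>a\<rangle>.\<close>

locale p_group_max_cyclic = group G for G (structure) +
  fixes p n m :: nat and a
  assumes fin: "finite (carrier G)"
    and p: "Factorial_Ring.prime p"
    and order_G: "order G = p ^ n"
    and a [simp]: "a \<in> carrier G"
    and ord_a: "ord a = p ^ m"
    and m: "m \<ge> 2"
    and ord_le: "\<And>x. x \<in> carrier G \<Longrightarrow> ord x \<le> p ^ m"
    and roots: "\<And>x. x \<in> carrier G \<Longrightarrow> x [^] p = \<one> \<Longrightarrow> x \<in> generate G {a}"
begin

abbreviation "A \<equiv> generate G {a}"

lemma A_iff: "x \<in> A \<longleftrightarrow> (\<exists>k::nat. x = a [^] k)"
  using generate_pow_on_finite_carrier[OF fin a] by auto

lemma A_subgroup: "subgroup A G"
  by (rule generate_is_subgroup) simp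

lemma a_pow_eq_one: "a [^] k = \<one> \<longleftrightarrow> p ^ m dvd k" for k :: nat
  by (simp add: pow_eq_id ord_a)

lemma p_pow_gt_0: "p ^ k > 0"
  using p prime_gt_0_nat by simp

lemma a_pow_eq:
  fixes i j :: nat
  shows "a [^] i = a [^] j \<longleftrightarrow> [i = j] (mod p ^ m)"
  using int_pow_eq[OF a, of "int i" "int j"]
  by (simp add: int_pow_int ord_a cong_int_iff[symmetric] cong_iff_dvd_diff dvd_diff_commute)

lemma ord_dvd: "ord x dvd p ^ m" if "x \<in> carrier G"
proof -
  have "ord x dvd p ^ n" using ord_dvd_group_order[OF that] order_G by simp
  then obtain k where k: "ord x = p ^ k" using divides_primepow_nat p by blast
  then have "k \<le> m"
    using ord_le[OF that] p prime_gt_1_nat power_le_imp_le_exp by metis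
  then show ?thesis by (simp add: k le_imp_power_dvd)
qed

text \<open>If \<open>p\<close> did not divide \<open>j\<close>, then \<open>a [^] j\<close> would
  generate \<open>A\<close> and \<open>a\<close> would be a power of \<open>x\<close>. By maximality
  of \<open>ord a\<close> the group generated by \<open>x\<close> would equal \<open>A\<close>,
  although \<open>x\<close> is outside.\<close>

lemma root_pow_dvd:
  fixes j :: nat
  assumes x: "x \<in> carrier G" "x \<notin> A" "x [^] p = a [^] j"
  shows "p dvd j"
proof (rule ccontr)
  assume "\<not> p dvd j"
  then have "coprime j (p ^ m)" using p by (metis coprime_commute coprime_power_right_iff prime_imp_coprime)
  then obtain s where "[j * s = 1] (mod p ^ m)"
    using cong_solve_coprime_nat by (metis One_nat_def)
  then have "a [^] (j * s) = a [^] (1::nat)" by (simp only: a_pow_eq)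
  then have "a = x [^] (p * s)"
    using x by (simp add: nat_pow_pow[symmetric])
  then have "a \<in> generate G {x}"
    using generate_pow_on_finite_carrier[OF fin x(1)] by auto
  then have "A \<subseteq> generate G {x}"
    using generate_subgroup_incl[OF _ generate_is_subgroup] x(1) by simp
  moreover have "card (generate G {x}) \<le> card A"
    using ord_le[OF x(1)] generate_pow_card x(1) a ord_a by metis
  moreover have "finite (generate G {x})"
    using finite_subset[OF generate_incl fin] x(1) by simp
  ultimately have "A = generate G {x}" using card_seteq by blast
  then show False using x(2) generate.incl[of x "{x}" G] by simp
qed

text \<open>The left-hand side is the exponent of \<open>a\<close> in \<open>(a\<^sup>i x)\<^sup>p\<close>, and \<open>A\<close> contains all elements of order \<open>p\<close>.\<close>

lemma no_cancelling_shift: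
  fixes r i j :: nat
  assumes x: "x \<in> carrier G" "x \<notin> A" "x \<otimes> a = a [^] r \<otimes> x" "x [^] p = a [^] j"
  shows "\<not> p ^ m dvd i * (\<Sum>l<p. r ^ l) + j"
proof
  assume "p ^ m dvd i * (\<Sum>l<p. r ^ l) + j"
  then have "(a [^] i \<otimes> x) [^] p = \<one>"
    using x by (simp add: pow_twisted_mult nat_pow_mult a_pow_eq_one)
  then have "a [^] i \<otimes> x \<in> A" using roots x(1) by simp
  moreover have "a [^] i \<in> A" using A_iff by blast
  ultimately show False
    using x(1,2) A_subgroup a by (metis nat_pow_closed subgroup.mem_carrier subgroup.m_inv_closed subgroup.m_closed inv_solve_left)
qed

text \<open>An element of \<open>A\<close> commutes with \<open>a\<close>, so conjugating
  \<open>a\<close> by \<open>x [^] k\<close> changes nothing.\<close>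

lemma twist_pow_cong_1:
  fixes r k :: nat
  assumes x: "x \<in> carrier G" "x \<otimes> a = a [^] r \<otimes> x" "x [^] k \<in> A"
  shows "[r ^ k = 1] (mod p ^ m)"
proof -
  obtain j :: nat where j: "x [^] k = a [^] j" using x(3) A_iff by blast
  have "a [^] (r ^ k) \<otimes> x [^] k = a \<otimes> x [^] k"
    using pow_twisted_left[OF x(1) a x(2), of k] j nat_pow_mult[of a j 1] nat_pow_mult[of a 1 j] by simp
  then have "a [^] (r ^ k) = a [^] (1::nat)" using x(1) by simp
  then show ?thesis using a_pow_eq by blast
qed

lemma ex_twist:
  assumes "x \<in> carrier G" "x \<otimes> a \<otimes> inv x \<in> A"
  obtains r :: nat where "x \<otimes> a = a [^] r \<otimes> x"
proof -
  obtain r :: nat where "x \<otimes> a \<otimes> inv x = a [^] r" using assms(2) A_iff by blast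
  then have "x \<otimes> a = a [^] r \<otimes> x" using assms(1) by (metis a inv_solve_right' m_closed nat_pow_closed)
  then show thesis using that by blast
qed

text \<open>Normalizer growth gives \<open>y\<close> outside \<open>A\<close>. The chain of iterated
  \<open>p\<close>-th powers of \<open>y\<close> ends at 1 and therefore enters \<open>A\<close>
  somewhere; its member just before an entry is the desired \<open>x\<close>.\<close>

lemma ex_outside_root:
  assumes "A \<noteq> carrier G"
  obtains x and r :: nat where "x \<in> carrier G" "x \<notin> A" "x \<otimes> a = a [^] r \<otimes> x" "x [^] p \<in> A"
proof -
  obtain y where y: "y \<in> carrier G" "y \<notin> A" "\<And>b. b \<in> A \<Longrightarrow> y \<otimes> b \<otimes> inv y \<in> A"
    using normalizer_grows[OF fin p order_G A_subgroup assms] by blast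
  have "a \<in> A" by (rule generate.incl) simp
  then obtain r :: nat where r: "y \<otimes> a = a [^] r \<otimes> y" using ex_twist y by blast
  obtain k where k: "y [^] (p ^ k) \<notin> A" "y [^] (p ^ Suc k) \<in> A"
  proof -
    have "y [^] (p ^ n) = \<one>" using pow_order_eq_1[OF y(1)] order_G by simp
    then have "y [^] (p ^ n) \<in> A" by (simp add: generate.one)
    moreover have "y [^] (p ^ 0) \<notin> A" using y by simp
    ultimately show thesis using that inc_induct[of 0 n "\<lambda>k. y [^] (p ^ k) \<in> A"] by blast
  qed
  show thesis
  proof
    show "y [^] (p ^ k) \<in> carrier G" using y(1) by simp
    show "y [^] (p ^ k) \<notin> A" by fact
    show "y [^] (p ^ k) \<otimes> a = a [^] (r ^ (p ^ k)) \<otimes> y [^] (p ^ k)"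
      by (rule pow_twisted_left[OF y(1) a r])
    show "(y [^] (p ^ k)) [^] p \<in> A"
      using k(2) y(1) by (simp add: nat_pow_pow mult.commute)
  qed
qed

lemma odd_imp_cyclic:
  assumes "odd p"
  shows "A = carrier G"
proof (rule ccontr)
  assume "A \<noteq> carrier G"
  then obtain x and r :: nat
    where x: "x \<in> carrier G" "x \<notin> A" "x \<otimes> a = a [^] r \<otimes> x" "x [^] p \<in> A"
    using ex_outside_root by blast
  obtain j :: nat where j: "x [^] p = a [^] j" using x(4) A_iff by blast
  have "p dvd p ^ m" using m by (simp add: dvd_power)
  then have "[r ^ p = 1] (mod p)"
    using twist_pow_cong_1[OF x(1,3,4)] cong_dvd_modulus_nat by blast
  \<comment> \<open>Fermat's little theorem reduces \<open>[r ^ p = 1] (mod p)\<close> to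
    \<open>[r = 1] (mod p)\<close>, the hypothesis of \<open>sum_power_odd_prime\<close>.\<close>
  moreover have "[r ^ p = r] (mod p)"
  proof (cases "p dvd r")
    case True
    then have "p dvd r ^ p" using p prime_gt_0_nat by (simp add: dvd_power_iff dvd_trans prime_dvd_power_iff)
    with True show ?thesis by (simp add: cong_def)
  next
    case False
    have "[r * r ^ (p - 1) = r * 1] (mod p)" by (intro cong_scalar_left fermat_theorem p False)
    then show ?thesis using p prime_gt_0_nat by (simp add: power_eq_if[of r p] split: if_splits)
  qed
  ultimately have "[r = 1] (mod p)" using cong_trans cong_sym by blast
  then obtain u where u: "(\<Sum>l<p. r ^ l) = p * u" "coprime u p"
    using sum_power_odd_prime[OF p assms] by blast
  \<comment> \<open>Both terms of the exponent \<open>i * (p * u) + j\<close> now contain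
    \<open>p\<close> and \<open>u\<close> is a unit, so some \<open>i\<close> makes it
    vanish.\<close>
  have "p dvd j" using root_pow_dvd[OF x(1,2) j] .
  then obtain i where "p ^ m dvd i * (p * u) + j"
    using cong_solve_affine_nat[of u "p ^ m" p j] u(2) p_pow_gt_0 by auto
  then show False using no_cancelling_shift[OF x(1-3) j, of i] u(1) by simp
qed

end

section \<open>The case of the prime 2\<close>

locale two_group_max_cyclic = p_group_max_cyclic G 2 n m a for G (structure) and n m a
begin

lemma two_pow_m: "(2::nat) ^ m = 4 * 2 ^ (m - 2)" "(2::nat) ^ m = 2 * 2 ^ (m - 1)"
  using m by (auto dest!: le_Suc_ex)

text \<open>The sum in \<open>no_cancelling_shift\<close> is \<open>1 + r\<close> here, so
  \<open>i * (1 + r) + j\<close> never vanishes modulo \<open>2 ^ m\<close>. Three choices of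
  \<open>i\<close> exploit this: one excludes \<open>r\<close> being 1 modulo 4,
  \<open>i = 0\<close> excludes that \<open>x\<close> squares to 1, and the last forces
  \<open>1 + r\<close> to vanish.\<close>

lemma outside_root_inverts:
  fixes r :: nat
  assumes x: "x \<in> carrier G" "x \<notin> A" "x \<otimes> a = a [^] r \<otimes> x" "x [^] (2::nat) \<in> A"
  shows "2 ^ m dvd 1 + r" and "x [^] (2::nat) = a [^] ((2::nat) ^ (m - 1))"
proof -
  have S: "(\<Sum>l<2. r ^ l) = 1 + r" by (simp add: numeral_2_eq_2)
  obtain j :: nat where j: "x [^] (2::nat) = a [^] j" using x(4) A_iff by blast
  have "even j" using root_pow_dvd[OF x(1,2) j] .
  have "[r ^ 2 = 1] (mod 2 ^ m)" using twist_pow_cong_1[OF x(1,3,4)] .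
  then have "[r ^ 2 = 1] (mod 2)" using two_pow_m(1) by (metis cong_dvd_modulus_nat dvd_triv_left two_pow_m(2))
  then have "odd (r ^ 2)" using cong_dvd_iff[of "r ^ 2" 1 2] by simp
  then have "odd r" by simp
  have r3: "r mod 4 = 3"
  proof (rule ccontr)
    assume "r mod 4 \<noteq> 3"
    then have "r mod 4 = 1" using \<open>odd r\<close> by presburger
    define u where "u = 2 * (r div 4) + 1"
    have "1 + r = 2 * u" using \<open>r mod 4 = 1\<close> unfolding u_def by presburger
    have "coprime u (2 ^ m)" by (simp add: u_def)
    then obtain i where "2 ^ m dvd i * (2 * u) + j"
      by (rule cong_solve_affine_nat[OF _ \<open>even j\<close>]) simp
    then show False using no_cancelling_shift[OF x(1-3) j, of i] unfolding S \<open>1 + r = 2 * u\<close> by blast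
  qed
  define v where "v = 2 * (r div 4) + 1"
  have v: "r = 1 + 2 * v" using r3 unfolding v_def by presburger
  \<comment> \<open>\<open>x\<close> commutes with its square \<open>a [^] j\<close>, so
    \<open>(r - 1) * j\<close> vanishes modulo \<open>2 ^ m\<close>. Since \<open>r - 1\<close> is
    twice the odd number \<open>v\<close>, this leaves \<open>j\<close> divisible by
    \<open>2 ^ (m - 1)\<close>.\<close>
  have "x \<otimes> x [^] (2::nat) = x [^] (2::nat) \<otimes> x"
    using x(1) by (simp add: numeral_2_eq_2 m_assoc)
  then have "a [^] (r * j) \<otimes> x = a [^] j \<otimes> x"
    using pow_twisted[OF x(1) a x(3), of j] unfolding j by simp
  then have "a [^] (r * j) = a [^] j" using x(1) by simp
  then have "[r * j = j] (mod 2 ^ m)" using a_pow_eq by blast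
  then have "2 ^ m dvd 2 * (v * j)"
    unfolding v by (simp add: cong_altdef_nat algebra_simps)
  then have "2 ^ (m - 1) dvd v * j" unfolding two_pow_m(2) by simp
  moreover have "coprime (2 ^ (m - 1)) v" by (simp add: v_def)
  ultimately have "2 ^ (m - 1) dvd j" by (simp add: coprime_dvd_mult_right_iff)
  then obtain q where q: "j = 2 ^ (m - 1) * q" by blast
  have "\<not> 2 ^ m dvd j" using no_cancelling_shift[OF x(1-3) j, of 0] by simp
  then have "odd q" unfolding q two_pow_m(2) by (auto elim!: evenE)
  then obtain q' where "q = 2 * q' + 1" by (elim oddE)
  then have "[j = 2 ^ (m - 1)] (mod 2 ^ m)"
    unfolding q two_pow_m(2) by (simp add: cong_def algebra_simps)
  then have aj: "a [^] j = a [^] ((2::nat) ^ (m - 1))" by (simp only: a_pow_eq)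
  then show "x [^] (2::nat) = a [^] ((2::nat) ^ (m - 1))" using j by simp
  show "2 ^ m dvd 1 + r"
  proof (rule ccontr)
    assume "\<not> 2 ^ m dvd 1 + r"
    then obtain i where "2 ^ m dvd i * (1 + r) + 2 ^ (m - 1)" by (rule dvd_half_solution)
    then show False using no_cancelling_shift[OF x(1-3), of "2 ^ (m - 1)" i] j aj unfolding S by simp
  qed
qed

text \<open>Otherwise some \<open>x [^] (2 ^ k)\<close> with \<open>k \<ge> 1\<close> is outside
  \<open>A\<close> while its square is inside, so it inverts \<open>a\<close>. But its twist
  exponent \<open>r ^ (2 ^ k)\<close> is a square, and -1 is not a square modulo 4.\<close>

lemma square_in_A:
  fixes r :: nat
  assumes x: "x \<in> carrier G" "x \<otimes> a = a [^] r \<otimes> x"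
  shows "x [^] (2::nat) \<in> A"
proof (rule ccontr)
  assume x2: "x [^] (2::nat) \<notin> A"
  have "x [^] ((2::nat) ^ n) = \<one>" using pow_order_eq_1[OF x(1)] order_G by simp
  then have end_in: "x [^] ((2::nat) ^ n) \<in> A" by (simp add: generate.one)
  moreover have "n \<ge> 1"
  proof (rule ccontr)
    assume "\<not> n \<ge> 1"
    then have "n = 0" by simp
    then have "x [^] ((2::nat) ^ n) = x" using x(1) by simp
    then show False using end_in x2 A_subgroup subgroup.m_closed[OF A_subgroup, of x x] x(1)
      by (simp add: numeral_2_eq_2)
  qed
  ultimately obtain k where k: "k \<ge> 1" "x [^] ((2::nat) ^ k) \<notin> A" "x [^] ((2::nat) ^ Suc k) \<in> A"
    using inc_induct[of 1 n "\<lambda>k. x [^] ((2::nat) ^ k) \<in> A"] x2 by fastforce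
  let ?y = "x [^] ((2::nat) ^ k)"
  have "?y \<otimes> a = a [^] (r ^ (2 ^ k)) \<otimes> ?y" by (rule pow_twisted_left[OF x(1) a x(2)])
  moreover have "?y [^] (2::nat) \<in> A" using k(3) x(1) by (simp add: nat_pow_pow mult.commute)
  ultimately have "2 ^ m dvd 1 + r ^ (2 ^ k)"
    using outside_root_inverts(1)[of ?y "r ^ (2 ^ k)"] k(2) x(1) by simp
  moreover have "r ^ (2 ^ k) = (r ^ (2 ^ (k - 1)))\<^sup>2"
    using k(1) by (simp flip: power_mult power_Suc2)
  ultimately show False
    using not_four_dvd_Suc_square[of "r ^ (2 ^ (k - 1))"] two_pow_m(1) by (metis dvd_trans dvd_triv_left)
qed

text \<open>Both twist exponents are -1 modulo 4, so that of \<open>x \<otimes> y\<close> is 1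
  modulo 4 and the product must lie in \<open>A\<close>. As the square of \<open>y\<close> is in
  \<open>A\<close> too, \<open>x\<close> and \<open>y\<close> share a coset.\<close>

lemma twisted_cosets:
  fixes r s :: nat
  assumes x: "x \<in> carrier G" "x \<notin> A" "x \<otimes> a = a [^] r \<otimes> x"
    and y: "y \<in> carrier G" "y \<notin> A" "y \<otimes> a = a [^] s \<otimes> y"
  obtains c where "c \<in> A" "x = c \<otimes> y"
proof -
  have xy: "(x \<otimes> y) \<otimes> a = a [^] (r * s) \<otimes> (x \<otimes> y)"
    by (rule twisted_mult[OF x(1,3) y(1,3) a])
  have inA: "x \<otimes> y \<in> A"
  proof (rule ccontr)
    assume notin: "x \<otimes> y \<notin> A"
    have "2 ^ m dvd 1 + r * s"
      using outside_root_inverts(1)[OF _ notin xy square_in_A[OF _ xy]] x(1) y(1) by simp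
    then have 4: "4 dvd 1 + r * s" using two_pow_m(1) by (metis dvd_trans dvd_triv_left)
    have "4 dvd 1 + r" "4 dvd 1 + s"
      using outside_root_inverts(1)[OF x square_in_A[OF x(1,3)]]
        outside_root_inverts(1)[OF y square_in_A[OF y(1,3)]] two_pow_m(1)
      by (metis dvd_trans dvd_triv_left)+
    then obtain u v where "1 + r = 4 * u" "1 + s = 4 * v" by (auto elim!: dvdE)
    then have rs: "int r = 4 * int u - 1" "int s = 4 * int v - 1" by linarith+
    have "int (1 + r * s) = 1 + int r * int s" by simp
    also have "\<dots> = 4 * (4 * int u * int v - int u - int v) + 2"
      unfolding rs by (simp add: algebra_simps)
    finally have "int (1 + r * s) = 4 * (4 * int u * int v - int u - int v) + 2" .
    moreover have "4 dvd int (1 + r * s)" using 4 by presburger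
    ultimately show False by presburger
  qed
  have y2: "y [^] (2::nat) \<in> A" by (rule square_in_A[OF y(1,3)])
  show thesis
  proof
    show "(x \<otimes> y) \<otimes> inv (y [^] (2::nat)) \<in> A"
      using inA y2 A_subgroup by (simp add: subgroup.m_closed subgroup.m_inv_closed)
    show "x = (x \<otimes> y) \<otimes> inv (y [^] (2::nat)) \<otimes> y"
    proof -
      have "inv (y [^] (2::nat)) = inv y \<otimes> inv y"
        using y(1) by (simp add: numeral_2_eq_2 inv_mult_group)
      then show ?thesis using x(1) y(1) by (simp add: m_assoc inv_mult_cancel)
    qed
  qed
qed

text \<open>This is the normalizer of \<open>A\<close>: as \<open>A\<close> is finite, conjugation
  into \<open>A\<close> is already onto. Exponents make the twist lemmas directly
  applicable.\<close>

definition "norm_A = {x \<in> carrier G. \<exists>r::nat. x \<otimes> a = a [^] r \<otimes> x}"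

lemma A_subset_norm_A: "A \<subseteq> norm_A"
proof
  fix x assume "x \<in> A"
  then obtain k :: nat where "x = a [^] k" using A_iff by blast
  then have "x \<in> carrier G \<and> x \<otimes> a = a [^] (1::nat) \<otimes> x"
    by (simp add: nat_pow_Suc2[symmetric])
  then show "x \<in> norm_A" unfolding norm_A_def by blast
qed

lemma mult_in_norm_A: "x \<otimes> y \<in> norm_A" if "x \<in> norm_A" "y \<in> norm_A"
  using that twisted_mult[OF _ _ _ _ a] unfolding norm_A_def by blast

lemma norm_A_subgroup: "subgroup norm_A G"
proof (rule subgroupI)
  show "norm_A \<subseteq> carrier G" unfolding norm_A_def by blast
  show "norm_A \<noteq> {}" using A_subset_norm_A generate.one[of G "{a}"] by blast
  show "x \<otimes> y \<in> norm_A" if "x \<in> norm_A" "y \<in> norm_A" for x y using that by (rule mult_in_norm_A)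
  show "inv x \<in> norm_A" if x: "x \<in> norm_A" for x
  proof -
    have xG: "x \<in> carrier G" using x unfolding norm_A_def by blast
    have "x [^] k \<in> norm_A" for k :: nat
    proof (induction k)
      case 0
      then show ?case using A_subset_norm_A generate.one[of G "{a}"] by auto
    next
      case (Suc k)
      then show ?case using mult_in_norm_A x by simp
    qed
    \<comment> \<open>In a finite group the inverse is a power, so closure under products
      suffices.\<close>
    moreover have "inv x = x [^] (order G - 1)"
    proof (rule inv_equality)
      have "x [^] (order G - 1) \<otimes> x = x [^] Suc (order G - 1)" by simp
      also have "Suc (order G - 1) = order G" using p_pow_gt_0 order_G by simp
      finally show "x [^] (order G - 1) \<otimes> x = \<one>" using pow_order_eq_1[OF xG] by simp
    qed (use xG in auto)
    ultimately show ?thesis by simp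
  qed
qed

text \<open>When \<open>A\<close> has order 4 it need not be characteristic in its normalizer, hence the case
  distinction: then all squares lie in \<open>A\<close>, because \<open>G\<close> has exponent 4.\<close>

lemma norm_A_eq_carrier: "norm_A = carrier G"
proof (rule ccontr)
  assume norm_A: "norm_A \<noteq> carrier G"
  then obtain c where c: "c \<in> carrier G" "c \<notin> norm_A" "\<And>b. b \<in> norm_A \<Longrightarrow> c \<otimes> b \<otimes> inv c \<in> norm_A"
    using normalizer_grows[OF fin p order_G norm_A_subgroup norm_A] by blast
  have "c \<otimes> a \<otimes> inv c \<in> A"
  proof (cases "m = 2")
    case True
    have sq: "w [^] (2::nat) \<in> A" if w: "w \<in> carrier G" for w
    proof (rule roots)
      have "ord w dvd 4" using ord_dvd[OF w] True by simp
      then have "w [^] (4::nat) = \<one>" using w pow_eq_id by blast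
      then show "(w [^] (2::nat)) [^] (2::nat) = \<one>" using w by (simp add: nat_pow_pow)
    qed (use w in simp)
    have aA: "a \<in> A" by (rule generate.incl) simp
    \<comment> \<open>The conjugate is rewritten as a product of squares and \<open>inv a\<close>,
      all of which lie in \<open>A\<close>.\<close>
    have "c \<otimes> a \<otimes> inv c = (c \<otimes> a) [^] (2::nat) \<otimes> inv a \<otimes> inv (c [^] (2::nat))"
    proof -
      have "(c \<otimes> a) [^] (2::nat) \<otimes> inv a = c \<otimes> a \<otimes> c"
        using c(1) by (simp add: numeral_2_eq_2 m_assoc)
      moreover have "inv (c [^] (2::nat)) = inv c \<otimes> inv c"
        using c(1) by (simp add: numeral_2_eq_2 inv_mult_group)
      ultimately show ?thesis
        using c(1) by (simp add: m_assoc inv_mult_cancel)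
    qed
    moreover have "(c \<otimes> a) [^] (2::nat) \<otimes> inv a \<otimes> inv (c [^] (2::nat)) \<in> A"
      using sq[of c] sq[of "c \<otimes> a"] c(1) aA A_subgroup
      by (simp add: subgroup.m_closed subgroup.m_inv_closed)
    ultimately show ?thesis by simp
  next
    case False
    then have "m \<ge> 3" using m by simp
    let ?y = "c \<otimes> a \<otimes> inv c"
    have y: "?y \<in> carrier G" using c(1) by simp
    show ?thesis
    proof (rule ccontr)
      assume notin: "?y \<notin> A"
      have "a \<in> norm_A" using A_subset_norm_A generate.incl[of a "{a}"] by blast
      then have "?y \<in> norm_A" using c(3) by blast
      then obtain r :: nat where r: "?y \<otimes> a = a [^] r \<otimes> ?y" unfolding norm_A_def by blast
      \<comment> \<open>Outside \<open>A\<close> the conjugate would square to an involution and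
        have order 4, whereas \<open>a\<close> has order at least 8.\<close>
      have "?y [^] (2::nat) = a [^] ((2::nat) ^ (m - 1))"
        using outside_root_inverts(2)[OF y notin r square_in_A[OF y r]] .
      then have "?y [^] (4::nat) = a [^] ((2::nat) ^ m)"
        using nat_pow_pow[OF y, of 2 2] two_pow_m(2) by (simp add: nat_pow_pow mult.commute)
      then have "?y [^] (4::nat) = \<one>" by (simp add: a_pow_eq_one)
      moreover have "?y [^] k = c \<otimes> a [^] k \<otimes> inv c" for k :: nat
        using hom_nat_pow[OF conj_hom[OF c(1)] a is_group is_group] by simp
      ultimately have "(c \<otimes> a [^] (4::nat)) \<otimes> inv c = c \<otimes> inv c" using c(1) by simp
      then have "a [^] (4::nat) = \<one>" using right_cancel[of "inv c" "c \<otimes> a [^] (4::nat)" c] c(1) by simp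
      then have "(2::nat) ^ m dvd 2 ^ 2" by (simp add: a_pow_eq_one)
      then show False using power_dvd_imp_le[of 2 m 2] \<open>m \<ge> 3\<close> by simp
    qed
  qed
  then obtain r :: nat where "c \<otimes> a = a [^] r \<otimes> c" by (rule ex_twist[OF c(1)])
  then have "c \<in> norm_A" using c(1) unfolding norm_A_def by blast
  then show False using c(2) by contradiction
qed

text \<open>Once every element normalizes \<open>A\<close>, any \<open>b\<close> outside
  \<open>A\<close> inverts \<open>a\<close> and squares to the involution, and
  \<open>twisted_cosets\<close> leaves room for only one further coset.\<close>

lemma cyclic_or_quaternion_relations:
  assumes "A \<noteq> carrier G"
  obtains b where "b \<in> carrier G" "b \<notin> A" "b \<otimes> a = inv a \<otimes> b"
    "b \<otimes> b = a [^] ((2::nat) ^ (m - 1))" "carrier G = A \<union> (A #> b)"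
proof -
  have AG: "A \<subseteq> carrier G" using A_subgroup subgroup.subset by blast
  obtain b where b: "b \<in> carrier G" "b \<notin> A" using assms AG by blast
  have twist: "\<exists>r::nat. x \<otimes> a = a [^] r \<otimes> x" if "x \<in> carrier G" for x
    using that norm_A_eq_carrier unfolding norm_A_def by blast
  obtain r :: nat where r: "b \<otimes> a = a [^] r \<otimes> b" using twist b(1) by blast
  note inv = outside_root_inverts[OF b r square_in_A[OF b(1) r]]
  show thesis
  proof
    show "b \<in> carrier G" "b \<notin> A" by fact+
    have "a [^] r \<otimes> a = \<one>" using inv(1) a_pow_eq_one[of "Suc r"] by simp
    then show "b \<otimes> a = inv a \<otimes> b" using r by (metis a inv_equality nat_pow_closed)
    show "b \<otimes> b = a [^] ((2::nat) ^ (m - 1))" using inv(2) b(1) by (simp add: numeral_2_eq_2)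
    have "x \<in> A #> b" if x: "x \<in> carrier G" "x \<notin> A" for x
    proof -
      obtain s :: nat where "x \<otimes> a = a [^] s \<otimes> x" using twist x(1) by blast
      then obtain c where "c \<in> A" "x = c \<otimes> b" using twisted_cosets[OF x _ b r] by blast
      then show ?thesis unfolding r_coset_def by blast
    qed
    then have "carrier G \<subseteq> A \<union> (A #> b)" by (metis UnI1 UnI2 subsetI)
    moreover have "A \<union> (A #> b) \<subseteq> carrier G"
      using AG r_coset_subset_G[OF AG b(1)] by (rule Un_least)
    ultimately show "carrier G = A \<union> (A #> b)" by (rule equalityI)
  qed
qed

end

section \<open>Generalized quaternion groups\<close>

text \<open>The pair \<open>(i, e)\<close> is sent to \<open>a^i b^e\<close>; the relations
  reproduce the multiplication of the model. The index is \<open>Suc m\<close> because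
  \<open>a\<close> has order \<open>2 ^ (n - 1)\<close> in
  \<open>quaternion_group n\<close>.\<close>

lemma (in group) quaternion_group_iso:
  assumes a: "a \<in> carrier G" "ord a = 2 ^ m" and m: "m \<ge> 1"
    and b: "b \<in> carrier G" "b \<notin> generate G {a}" "b \<otimes> a = inv a \<otimes> b"
      "b \<otimes> b = a [^] ((2::nat) ^ (m - 1))"
    and carrier: "carrier G = generate G {a} \<union> (generate G {a} #> b)"
  shows "G \<cong> quaternion_group (Suc m)"
proof -
  let ?Q = "quaternion_group (Suc m)"
  define f where "f = (\<lambda>(i::int, e). a [^] i \<otimes> (if e then b else \<one>))"
  have f_simps: "f (i, False) = a [^] i" "f (i, True) = a [^] i \<otimes> b" for i
    using a by (simp_all add: f_def)
  have gen: "x \<in> generate G {a} \<longleftrightarrow> (\<exists>k::int. x = a [^] k)" for x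
    using generate_pow[OF a(1)] by auto
  have pow_mod: "a [^] (i mod 2 ^ m) = a [^] i" for i :: int
    unfolding int_pow_eq[OF a(1)] by (simp add: a(2) minus_mod_eq_mult_div)
  have ba: "b \<otimes> a [^] j = a [^] (- j) \<otimes> b" for j :: int
  proof -
    have *: "b \<otimes> a \<otimes> inv b = inv a" using a(1) b(1,3) by (simp add: inv_solve_right')
    have "b \<otimes> a [^] j \<otimes> inv b = (b \<otimes> a \<otimes> inv b) [^] j"
      using hom_int_pow[OF conj_hom[OF b(1)] a(1) is_group is_group] .
    then have "b \<otimes> a [^] j \<otimes> inv b = a [^] (- j)"
      using * a(1) by (simp add: int_pow_inv int_pow_neg)
    then show ?thesis using a(1) b(1) by (metis int_pow_closed inv_solve_right' m_closed)
  qed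
  have bb: "b \<otimes> b = a [^] ((2::int) ^ (m - 1))"
    using b(4) int_pow_int[of G a "2 ^ (m - 1)"] by simp
  have closed: "quaternion_mult (Suc m) u v \<in> carrier ?Q" for u v
    by (auto simp: quaternion_mult_def quaternion_group_def Let_def)
  have hom: "f (quaternion_mult (Suc m) u v) = f u \<otimes> f v" for u v
  proof -
    obtain i e j g where uv: "u = (i, e)" "v = (j, g)" by fastforce
    have 1: "a [^] i \<otimes> b \<otimes> a [^] j = a [^] (i - j) \<otimes> b"
      using a(1) b(1) by (simp add: m_assoc ba) (simp add: int_pow_diff int_pow_neg flip: m_assoc)
    have 2: "a [^] i \<otimes> b \<otimes> (a [^] j \<otimes> b) = a [^] (i - j + 2 ^ (m - 1))"
    proof -
      have "a [^] i \<otimes> b \<otimes> (a [^] j \<otimes> b) = a [^] (i - j) \<otimes> (b \<otimes> b)"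
        using a(1) b(1) 1 by (simp add: m_assoc[symmetric])
      then show ?thesis using a(1) by (simp add: bb int_pow_mult)
    qed
    show ?thesis
      unfolding uv using a(1) b(1) 1 2
      by (cases e; cases g)
        (simp_all add: quaternion_mult_def Let_def f_simps pow_mod int_pow_mult m_assoc)
  qed
  have inj: "inj_on f (carrier ?Q)"
  proof (rule inj_onI)
    fix u v assume u: "u \<in> carrier ?Q" and v: "v \<in> carrier ?Q" and eq: "f u = f v"
    obtain i e j g where uv: "u = (i, e)" "v = (j, g)" by fastforce
    have no: "a [^] i \<noteq> a [^] j \<otimes> b" for i j :: int
    proof
      assume "a [^] i = a [^] j \<otimes> b"
      then have "a [^] (- j) \<otimes> a [^] i = b"
        using a(1) b(1) by (simp add: int_pow_neg inv_mult_cancel)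
      then have "b = a [^] (- j + i)" using a(1) int_pow_mult by metis
      then show False using b(2) gen by blast
    qed
    have "e = g" using eq no[of i j] no[of j i] unfolding uv by (cases e; cases g) (auto simp: f_simps)
    moreover have "a [^] i = a [^] j"
      using eq \<open>e = g\<close> a(1) b(1) unfolding uv by (cases g) (auto simp: f_simps)
    then have "(2::int) ^ m dvd j - i" using int_pow_eq[OF a(1)] a(2) by simp
    then have "j mod 2 ^ m = i mod 2 ^ m" by (simp add: mod_eq_dvd_iff)
    then have "i = j" using u v unfolding uv by (simp add: quaternion_group_def)
    ultimately show "u = v" using uv by simp
  qed
  have surj: "f ` carrier ?Q = carrier G"
  proof
    show "f ` carrier ?Q \<subseteq> carrier G" using a(1) b(1) by (auto simp: f_def)
    show "carrier G \<subseteq> f ` carrier ?Q"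
    proof
      fix x assume "x \<in> carrier G"
      then have "(\<exists>i::int. x = a [^] i) \<or> (\<exists>i::int. x = a [^] i \<otimes> b)"
        using carrier gen by (auto simp: r_coset_def)
      then obtain i e where "x = f (i, e)" using f_simps by metis
      then have "x = f (i mod 2 ^ m, e)" by (simp add: f_def pow_mod)
      then show "x \<in> f ` carrier ?Q" by (auto simp: quaternion_group_def)
    qed
  qed
  \<comment> \<open>The isomorphism must start at \<open>G\<close>, so \<open>f\<close> is
    inverted.\<close>
  let ?g = "inv_into (carrier ?Q) f"
  have bij: "bij_betw f (carrier ?Q) (carrier G)" using inj surj by (simp add: bij_betw_def)
  have "?g \<in> hom G ?Q"
  proof (rule homI)
    fix x y assume xy: "x \<in> carrier G" "y \<in> carrier G"
    show gx: "?g x \<in> carrier ?Q" using xy(1) surj by (simp add: inv_into_into)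
    have mult: "?g x \<otimes>\<^bsub>?Q\<^esub> ?g y = quaternion_mult (Suc m) (?g x) (?g y)"
      by (simp add: quaternion_group_def)
    then have "f (?g x \<otimes>\<^bsub>?Q\<^esub> ?g y) = x \<otimes> y"
      using xy surj hom by (simp add: f_inv_into_f)
    moreover have "?g x \<otimes>\<^bsub>?Q\<^esub> ?g y \<in> carrier ?Q" using closed mult by simp
    ultimately show "?g (x \<otimes> y) = ?g x \<otimes>\<^bsub>?Q\<^esub> ?g y"
      using inv_into_f_eq[OF inj] by blast
  qed
  then have "?g \<in> iso G ?Q" using bij_betw_inv_into[OF bij] by (simp add: iso_def)
  then show ?thesis unfolding is_iso_def by blast
qed

section \<open>Breaking points\<close>

lemma (in group) generate_singleton_mono:
  assumes "x \<in> carrier G" "y \<in> generate G {x}"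
  shows "generate G {y} \<subseteq> generate G {x}"
  using generate_subgroup_incl[OF _ generate_is_subgroup, of "{y}" "{x}"] assms by simp

lemma (in group) generate_singleton_eqI:
  assumes "finite (carrier G)" "x \<in> carrier G" "y \<in> generate G {x}" "ord x \<le> ord y"
  shows "generate G {y} = generate G {x}"
proof (rule card_seteq)
  have "generate G {x} \<subseteq> carrier G" using generate_incl assms(2) by simp
  then show "finite (generate G {x})" using assms(1) finite_subset by blast
  have "y \<in> carrier G" using assms(2,3) generate_in_carrier[of "{x}" y] by simp
  then show "card (generate G {x}) \<le> card (generate G {y})"
    using assms(2,4) by (simp flip: generate_pow_card)
qed (rule generate_singleton_mono[OF assms(2,3)])

lemma (in group) pow_in_generate:
  fixes k :: nat
  assumes "x \<in> carrier G"
  shows "x [^] k \<in> generate G {x}"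
  unfolding generate_pow[OF assms] int_pow_int[symmetric] by blast

lemma (in group) subgroup_card_dvd:
  assumes "subgroup H G" "subgroup K G" "H \<subseteq> K"
  shows "card H dvd card K"
proof -
  let ?K = "G\<lparr>carrier := K\<rparr>"
  have "card (rcosets\<^bsub>?K\<^esub> H) * card H = card K"
    using group.lagrange[OF subgroup.subgroup_is_group[OF assms(2) is_group] subgroup_incl[OF assms]]
    by (simp add: order_def)
  then show ?thesis by (metis dvd_triv_right)
qed

lemma (in group) ord_dvd_subgroup_card:
  assumes S: "subgroup S G" "x \<in> S"
  shows "ord x dvd card S"
proof -
  have x: "x \<in> carrier G" using S by (rule subgroup.mem_carrier)
  have "generate G {x} \<subseteq> S" using generate_subgroup_incl[OF _ S(1), of "{x}"] S(2) by simp
  then have "card (generate G {x}) dvd card S"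
    using subgroup_card_dvd[OF generate_is_subgroup S(1)] x by simp
  then show ?thesis using generate_pow_card[OF x] by simp
qed

section \<open>Groups with a single subgroup of prime order have a breaking point\<close>

lemma (in group) ex_prime_order_power:
  assumes "finite (carrier G)" "Factorial_Ring.prime p" "order G = p ^ n" "x \<in> carrier G" "x \<noteq> \<one>"
  obtains k :: nat where "ord (x [^] k) = p"
proof -
  obtain k where k: "ord x = p ^ k"
    using ord_dvd_group_order[OF assms(4)] assms(2,3) divides_primepow_nat by metis
  have "k \<noteq> 0" using k ord_eq_1[OF assms(4)] assms(5) by auto
  then have "p ^ k = p ^ (k - 1) * p" by (simp add: power_eq_if)
  moreover have "p ^ (k - 1) \<noteq> 0" using assms(2) by auto
  ultimately have "ord (x [^] (p ^ (k - 1))) = p"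
    using ord_pow[OF assms(4), of "p ^ (k - 1)"] k by simp
  then show thesis using that by blast
qed

text \<open>A nontrivial cyclic subgroup of a \<open>p\<close>-group contains an element of order
  \<open>p\<close>. By \<open>roots\<close> this element generates the same subgroup as
  \<open>w\<close>. The cyclic and the quaternion case both go through this criterion.\<close>

lemma (in group) breaking_pointI_p_group:
  assumes fin: "finite (carrier G)" and p: "Factorial_Ring.prime p" "order G = p ^ n"
    and w: "w \<in> carrier G" "ord w = p" "order G \<noteq> p"
    and roots: "\<And>x. x \<in> carrier G \<Longrightarrow> x [^] p = \<one> \<Longrightarrow> x \<in> generate G {w}"
  shows "breaking_point G (generate G {w})"
  unfolding breaking_point_def
proof (intro conjI ballI)
  have card: "card (generate G {w}) = p" using w generate_pow_card by metis
  show "generate G {w} \<in> cyclic_subgroups G" using w(1) unfolding cyclic_subgroups_def by blast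
  show "generate G {w} \<noteq> {\<one>}" using card p(1) by (metis card.empty card_insert_disjoint empty_iff finite.emptyI not_prime_1 One_nat_def)
  show "generate G {w} \<noteq> carrier G" using card w(3) unfolding order_def by auto
  fix K assume "K \<in> cyclic_subgroups G"
  then obtain x where x: "x \<in> carrier G" "K = generate G {x}" unfolding cyclic_subgroups_def by blast
  show "K \<subseteq> generate G {w} \<or> generate G {w} \<subseteq> K"
  proof (cases "x = \<one>")
    case True
    then show ?thesis using x generate_singleton_mono[OF w(1) generate.one] by simp
  next
    case False
    obtain k :: nat where k: "ord (x [^] k) = p"
      using ex_prime_order_power[OF fin p x(1) False] by blast
    have xk: "x [^] k \<in> carrier G" using x(1) by simp
    have "x [^] k \<in> generate G {w}" using roots[OF xk] pow_eq_id[OF xk] k by simp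
    then have "generate G {x [^] k} = generate G {w}"
      using generate_singleton_eqI[OF fin w(1)] k w(2) by simp
    then show ?thesis
      using generate_singleton_mono[OF x(1) pow_in_generate[OF x(1)]] x(2) by metis
  qed
qed

lemma (in group) cyclic_p_group_breaking_point:
  assumes fin: "finite (carrier G)" and cyc: "cyclic_group G"
    and p: "Factorial_Ring.prime p" "k \<ge> 2" "order G = p ^ k"
  shows "\<exists>H. breaking_point G H"
proof -
  obtain g where g: "g \<in> carrier G" "carrier G = range (\<lambda>n::int. g [^] n)"
    using cyc cyclic_group by blast
  then have gen: "carrier G = generate G {g}" using generate_pow[OF g(1)] by auto
  then have ord: "ord g = p ^ k" using generate_pow_card[OF g(1)] p(3) unfolding order_def by simp
  \<comment> \<open>\<open>w\<close> generates the unique subgroup of order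
    \<open>p\<close>.\<close>
  define w where "w = g [^] (p ^ (k - 1))"
  have p0: "p ^ (k - 1) > 0" using p(1) prime_gt_0_nat by simp
  have pk: "p ^ k = p ^ (k - 1) * p" using p(2) by (simp add: power_eq_if)
  have "p ^ (k - 1) dvd ord g" unfolding ord pk by (rule dvd_triv_left)
  then have "ord w = p ^ (k - 1) * p div p ^ (k - 1)"
    unfolding w_def pk[symmetric] ord[symmetric] using ord_pow[OF g(1)] p0 by blast
  then have w: "w \<in> carrier G" "ord w = p"
    using g(1) p0 by (simp_all add: w_def)
  have "order G \<noteq> p"
    using p prime_gt_1_nat[OF p(1)] power_inject_exp[of p k 1] by simp
  moreover have "x \<in> generate G {w}" if x: "x \<in> carrier G" "x [^] p = \<one>" for x
  proof -
    obtain t :: nat where t: "x = g [^] t"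
      using x(1) gen generate_pow_on_finite_carrier[OF fin g(1)] by auto
    then have "p ^ k dvd t * p"
      using x(2) g(1) pow_eq_id[OF g(1)] ord by (simp add: nat_pow_pow)
    then have "p ^ (k - 1) dvd t" unfolding pk using p(1) by (simp add: prime_gt_0_nat)
    then obtain s where "t = p ^ (k - 1) * s" by blast
    then have "x = w [^] s" using t g(1) by (simp add: w_def nat_pow_pow)
    then show ?thesis using pow_in_generate[OF w(1)] by simp
  qed
  ultimately show ?thesis
    using breaking_pointI_p_group[OF fin p(1,3) w] by blast
qed

lemma (in group) quaternion_breaking_point:
  assumes fin: "finite (carrier G)" and n: "n \<ge> 3" and iso: "G \<cong> quaternion_group n"
  shows "\<exists>H. breaking_point G H"
proof -
  let ?Q = "quaternion_group n"
  have Q: "carrier ?Q = {0..<2 ^ (n - 1)} \<times> UNIV" "monoid.mult ?Q = quaternion_mult n"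
    by (simp_all add: quaternion_group_def)
  obtain f where f: "f \<in> hom G ?Q" "bij_betw f (carrier G) (carrier ?Q)"
    using iso unfolding is_iso_def iso_def by blast
  have mult: "f (x \<otimes> y) = quaternion_mult n (f x) (f y)"
    if "x \<in> carrier G" "y \<in> carrier G" for x y
    using hom_mult[OF f(1) that] Q(2) by simp
  have fQ: "f x \<in> carrier ?Q" if "x \<in> carrier G" for x using hom_in_carrier[OF f(1) that] .
  have inj: "x = y" if "f x = f y" "x \<in> carrier G" "y \<in> carrier G" for x y
    using f(2) that unfolding bij_betw_def inj_on_def by blast
  \<comment> \<open>\<open>h\<close> is half the order of \<open>a\<close>, so
    \<open>(h, False)\<close> is the involution.\<close>
  define h :: int where "h = 2 ^ (n - 2)"
  have N: "(2::int) ^ (n - 1) = 2 * h" "h > 0"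
    using n by (auto simp: h_def dest!: le_Suc_ex)
  have square: "u = (0, False) \<or> u = (h, False)"
    if u: "u \<in> carrier ?Q" "quaternion_mult n u u = (0, False)" for u
  proof -
    obtain i e where ie: "u = (i, e)" by fastforce
    have i: "0 \<le> i" "i < 2 * h" using u(1) N(1) unfolding ie Q by auto
    \<comment> \<open>Every \<open>(i, True)\<close> squares to \<open>(h, False)\<close>, which is
      not the identity.\<close>
    have "\<not> e" using u(2) N unfolding ie h_def[symmetric] quaternion_mult_def
      by (auto simp: Let_def)
    then have "(i + i) mod (2 * h) = 0" using u(2) N(1) unfolding ie quaternion_mult_def by simp
    then have "h dvd i" by (simp add: mod_eq_0_iff_dvd flip: mult_2)
    then obtain q where q: "i = h * q" by blast
    then have "q \<ge> 0" "q < 2" using i N(2) by (simp_all add: zero_le_mult_iff)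
    then have "q = 0 \<or> q = 1" by linarith
    then show ?thesis using q ie \<open>\<not> e\<close> by auto
  qed
  \<comment> \<open>The image of the identity is found as an idempotent, which avoids verifying the
    group axioms for the model.\<close>
  have f1: "f \<one> = (0, False)"
  proof -
    obtain i e where ie: "f \<one> = (i, e)" by fastforce
    have i: "0 \<le> i" "i < 2 * h" using fQ[OF one_closed] N(1) unfolding ie Q by auto
    have eq: "quaternion_mult n (i, e) (i, e) = (i, e)" using mult[of \<one> \<one>] ie by simp
    then have "\<not> e" by (auto simp: quaternion_mult_def Let_def)
    then have "(i + i) mod (2 * h) = i mod (2 * h)"
      using eq N(1) i by (simp add: quaternion_mult_def)
    then have "2 * h dvd i" unfolding mod_eq_dvd_iff by simp
    then have "i = 0" using i zdvd_imp_le[of "2 * h" i] by linarith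
    then show ?thesis using ie \<open>\<not> e\<close> by simp
  qed
  have "(h, False) \<in> carrier ?Q" using N Q by simp
  then obtain w where w: "w \<in> carrier G" "f w = (h, False)"
    using f(2) unfolding bij_betw_def by (metis imageE)
  have "f (w \<otimes> w) = (0, False)" using mult[OF w(1) w(1)] w(2) N(1) by (simp add: quaternion_mult_def)
  then have "w \<otimes> w = \<one>" using inj[of "w \<otimes> w" \<one>] f1 w(1) by simp
  then have "ord w dvd 2" using w(1) pow_eq_id[of w 2] by (simp add: numeral_2_eq_2)
  moreover have "w \<noteq> \<one>" using f1 w(2) N(2) by auto
  ultimately have ord_w: "ord w = 2"
    using prime_nat_iff[of 2] two_is_prime_nat ord_eq_1[OF w(1)] by blast
  have order: "order G = 2 ^ n"
  proof -
    have "order G = card (carrier ?Q)" using bij_betw_same_card[OF f(2)] by (simp add: order_def)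
    also have "\<dots> = nat (2 ^ (n - 1)) * 2" unfolding Q by (simp add: card_cartesian_product)
    also have "\<dots> = 2 ^ n" using n by (simp add: nat_power_eq power_eq_if[of _ n])
    finally show ?thesis .
  qed
  have "order G \<noteq> 2" using order n power_inject_exp[of "2::nat" n 1] by simp
  moreover have "x \<in> generate G {w}" if x: "x \<in> carrier G" "x [^] (2::nat) = \<one>" for x
  proof -
    have "quaternion_mult n (f x) (f x) = (0, False)"
      using mult[OF x(1) x(1)] x f1 by (simp add: numeral_2_eq_2)
    then have "f x = f \<one> \<or> f x = f w" using square fQ x(1) f1 w(2) by simp
    then have "x = \<one> \<or> x = w" using inj x(1) w(1) by blast
    then show ?thesis using generate.one[of G "{w}"] generate.incl[of w "{w}" G] by auto
  qed
  ultimately show ?thesis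
    using breaking_pointI_p_group[OF fin two_is_prime_nat order w(1) ord_w] by blast
qed

section \<open>The structure of a group with a breaking point\<close>

lemma (in group) prime_order_in_breaking_point:
  assumes fin: "finite (carrier G)" and H: "breaking_point G H"
    and x: "x \<in> carrier G" "Factorial_Ring.prime (ord x)"
  shows "x \<in> H"
proof -
  obtain h where h: "h \<in> carrier G" "H = generate G {h}"
    using H unfolding breaking_point_def cyclic_subgroups_def by blast
  have x_in: "x \<in> generate G {x}" by (rule generate.incl) simp
  have "generate G {x} \<subseteq> H \<or> H \<subseteq> generate G {x}"
    using H x(1) unfolding breaking_point_def cyclic_subgroups_def by blast
  then show ?thesis
  proof
    \<comment> \<open>A nontrivial subgroup of a group of prime order is the whole of it.\<close>
    assume "H \<subseteq> generate G {x}"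
    then have hx: "h \<in> generate G {x}" using h(2) generate.incl[of h "{h}" G] by blast
    then obtain k :: nat where k: "h = x [^] k"
      using generate_pow_on_finite_carrier[OF fin x(1)] by blast
    have "h [^] ord x = (x [^] ord x) [^] k" using x(1) unfolding k nat_pow_pow[OF x(1)] by (simp add: mult.commute)
    then have "ord h dvd ord x" using h(1) x(1) pow_eq_id[OF h(1)] by simp
    moreover have "h \<noteq> \<one>"
      using H h(2) generate_one unfolding breaking_point_def by metis
    ultimately have "ord h = ord x"
      using x(2) ord_eq_1[OF h(1)] prime_nat_iff by blast
    then have "H = generate G {x}" using generate_singleton_eqI[OF fin x(1) hx] h(2) by simp
    then show ?thesis using x_in by simp
  qed (use x_in in blast)
qed

lemma (in group) breaking_point_imp_p_group:
  assumes fin: "finite (carrier G)" and H: "breaking_point G H"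
  obtains p n where "Factorial_Ring.prime p" "order G = p ^ n"
proof (rule ccontr)
  assume "\<not> thesis"
  with that have no: "order G \<noteq> p ^ n" if "Factorial_Ring.prime p" for p n
    using \<open>Factorial_Ring.prime p\<close> by blast
  obtain h where h: "h \<in> carrier G" "H = generate G {h}"
    using H unfolding breaking_point_def cyclic_subgroups_def by blast
  have H_sub: "subgroup H G" unfolding h(2) by (rule generate_is_subgroup) (use h in simp)
  have G0: "order G \<noteq> 0" using fin order_gt_0_iff_finite by simp
  have prime_dvd: "q dvd card H" if q: "Factorial_Ring.prime q" "q dvd order G" for q
  proof -
    obtain c where "order G = q ^ 1 * c" using q(2) by auto
    \<comment> \<open>Sylow's theorem with exponent 1 serves as Cauchy's theorem.\<close>
    then obtain S where S: "subgroup S G" "card S = q ^ 1"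
      using sylow_thm[OF q(1) is_group _ fin] by blast
    have "S \<noteq> {\<one>}" using S(2) q(1) by auto
    moreover have "\<one> \<in> S" by (rule subgroup.one_closed[OF S(1)])
    ultimately obtain x where x: "x \<in> S" "x \<noteq> \<one>" by blast
    have xG: "x \<in> carrier G" using subgroup.mem_carrier[OF S(1) x(1)] .
    have "ord x dvd q" using ord_dvd_subgroup_card[OF S(1) x(1)] S(2) by simp
    then have ord: "ord x = q" using q(1) x(2) ord_eq_1[OF xG] prime_nat_iff by blast
    then have "x \<in> H" using prime_order_in_breaking_point[OF fin H xG] q(1) by simp
    then obtain k :: nat where "x = h [^] k"
      using generate_pow_on_finite_carrier[OF fin h(1)] h(2) by blast
    then have "x [^] ord h = (h [^] ord h) [^] k"
      using h(1) by (simp add: nat_pow_pow mult.commute del: pow_ord_eq_1)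
    then have "ord x dvd ord h" using pow_eq_id[OF xG] h(1) by simp
    then show ?thesis using ord generate_pow_card[OF h(1)] h(2) by simp
  qed
  have power_dvd: "q ^ multiplicity q (order G) dvd card H" if q: "Factorial_Ring.prime q" for q
  proof -
    define e where "e = multiplicity q (order G)"
    have "\<not> q dvd 1" using q not_prime_unit by blast
    then obtain c where c: "order G = q ^ e * c" "\<not> q dvd c"
      using multiplicity_decompose'[OF G0] unfolding e_def by metis
    obtain S where S: "subgroup S G" "card S = q ^ e"
      using sylow_thm[OF q is_group c(1) fin] by blast
    \<comment> \<open>As \<open>G\<close> is not a \<open>q\<close>-group, a second prime
      \<open>s\<close> divides its order, and hence \<open>card H\<close>. This keeps
      \<open>H\<close> out of every cyclic \<open>q\<close>-group.\<close>
    have "c \<noteq> 1"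
    proof
      assume "c = 1"
      then have "order G = q ^ e" using c(1) by (simp only: mult_1_right)
      then show False using no[OF q, of e] by contradiction
    qed
    then obtain s where s: "Factorial_Ring.prime s" "s dvd c" using prime_factor_nat by blast
    have "s dvd card H" using prime_dvd s c(1) by simp
    have "s \<noteq> q" using s(2) c(2) by blast
    have "S \<subseteq> H"
    proof
      fix x assume x: "x \<in> S"
      have xG: "x \<in> carrier G" using subgroup.mem_carrier[OF S(1) x] .
      have ord: "ord x dvd q ^ e" using ord_dvd_subgroup_card[OF S(1) x] S(2) by simp
      have "\<not> H \<subseteq> generate G {x}"
      proof
        assume "H \<subseteq> generate G {x}"
        moreover have "subgroup (generate G {x}) G" using xG by (simp add: generate_is_subgroup)
        ultimately have "card H dvd ord x"
          using subgroup_card_dvd[OF H_sub] generate_pow_card[OF xG] by simp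
        then have "s dvd q ^ e" using \<open>s dvd card H\<close> ord dvd_trans by blast
        then show False using s(1) q \<open>s \<noteq> q\<close> prime_dvd_power primes_dvd_imp_eq by blast
      qed
      then have "generate G {x} \<subseteq> H"
        using H xG unfolding breaking_point_def cyclic_subgroups_def by blast
      then show "x \<in> H" using generate.incl[of x "{x}" G] by blast
    qed
    then have "card S dvd card H" by (rule subgroup_card_dvd[OF S(1) H_sub])
    then show ?thesis using S(2) e_def by simp
  qed
  have "card H \<noteq> 0"
    using subgroup.finite_imp_card_positive[OF H_sub fin] by simp
  have "order G dvd card H"
  proof (rule multiplicity_le_imp_dvd[OF G0])
    show "multiplicity q (order G) \<le> multiplicity q (card H)" if "Factorial_Ring.prime q" for q
      using power_dvd[OF that] \<open>card H \<noteq> 0\<close> not_prime_unit that by (intro multiplicity_geI) blast+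
  qed
  then have "card (carrier G) \<le> card H" using \<open>card H \<noteq> 0\<close> by (simp add: order_def dvd_imp_le)
  then have "H = carrier G" using card_seteq[OF fin subgroup.subset[OF H_sub]] by simp
  then show False using H unfolding breaking_point_def by blast
qed

lemma (in group) breaking_point_imp_max_cyclic:
  assumes fin: "finite (carrier G)" and H: "breaking_point G H"
  obtains p n m a where "p_group_max_cyclic G p n m a"
proof -
  obtain p n where p: "Factorial_Ring.prime p" "order G = p ^ n"
    using breaking_point_imp_p_group[OF fin H] by blast
  obtain h where h: "h \<in> carrier G" "H = generate G {h}"
    using H unfolding breaking_point_def cyclic_subgroups_def by blast
  have "Max (ord ` carrier G) \<in> ord ` carrier G" using fin by (intro Max_in) auto
  then obtain a where a: "a \<in> carrier G" "ord a = Max (ord ` carrier G)" by (metis imageE)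
  then have ord_le: "ord x \<le> ord a" if "x \<in> carrier G" for x using fin that by simp
  have comparable: "generate G {x} \<subseteq> H \<or> H \<subseteq> generate G {x}" if "x \<in> carrier G" for x
    using H that unfolding breaking_point_def cyclic_subgroups_def by blast
  have self: "x \<in> generate G {x}" for x by (rule generate.incl) simp
  \<comment> \<open>Otherwise maximality gives \<open>H\<close> = \<langle>a\<rangle>, and no cyclic
    subgroup can properly contain \<open>H\<close>. Then \<open>H\<close> contains every element and
    equals \<open>G\<close>.\<close>
  have not_sub: "\<not> generate G {a} \<subseteq> H"
  proof
    assume "generate G {a} \<subseteq> H"
    then have "a \<in> generate G {h}" using self h(2) by blast
    then have ord_h: "ord h = ord a" "generate G {a} = H"
      using generate_singleton_eqI[OF fin h(1) _ ord_le[OF h(1)]] h(2) generate_pow_card[OF h(1)] generate_pow_card[OF a(1)] by simp_all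
    have "x \<in> H" if x: "x \<in> carrier G" for x
      using comparable[OF x]
    proof
      assume "H \<subseteq> generate G {x}"
      then have "h \<in> generate G {x}" using self h(2) by blast
      then have "H = generate G {x}"
        using generate_singleton_eqI[OF fin x] ord_h(1) ord_le[OF x] h(2) by simp
      then show ?thesis using self by simp
    qed (use self in blast)
    then have "carrier G \<subseteq> H" by blast
    moreover have "H \<subseteq> carrier G" using generate_incl h by simp
    ultimately show False using H unfolding breaking_point_def by blast
  qed
  then have HA: "H \<subseteq> generate G {a}" using comparable[OF a(1)] by blast
  obtain m where m: "ord a = p ^ m"
    using ord_dvd_group_order[OF a(1)] p divides_primepow_nat by metis
  \<comment> \<open>If \<open>a\<close> had order \<open>p\<close>, it would lie in
    \<open>H\<close>, against \<open>not_sub\<close>.\<close>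
  have "m \<ge> 2"
  proof (rule ccontr)
    assume "\<not> m \<ge> 2"
    then have "m = 0 \<or> m = 1" by linarith
    moreover have "a \<noteq> \<one>"
      using not_sub generate_one generate.one[of G "{h}"] h(2) by auto
    ultimately have "ord a = p" using m ord_eq_1[OF a(1)] by auto
    then have "a \<in> H" using prime_order_in_breaking_point[OF fin H a(1)] p(1) by simp
    then show False using not_sub generate_singleton_mono[OF h(1)] h(2) by blast
  qed
  have "p_group_max_cyclic G p n m a"
  proof
    show "x \<in> generate G {a}" if x: "x \<in> carrier G" "x [^] p = \<one>" for x
    proof (cases "x = \<one>")
      case True
      then show ?thesis by (simp add: generate.one)
    next
      case False
      have "ord x dvd p" using x pow_eq_id by simp
      then have "ord x = p" using p(1) False ord_eq_1[OF x(1)] prime_nat_iff by blast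
      then show ?thesis using prime_order_in_breaking_point[OF fin H x(1)] p(1) HA by auto
    qed
  qed (use fin p a(1) m \<open>m \<ge> 2\<close> ord_le in auto)
  then show thesis using that by blast
qed

lemma (in p_group_max_cyclic) cyclic_or_quaternion:
  "cyclic_group G \<and> order G = p ^ m \<or> G \<cong> quaternion_group (Suc m)"
proof (cases "A = carrier G")
  case True
  have "carrier G = range (\<lambda>n::int. a [^] n)" using generate_pow[OF a] True by auto
  then have "cyclic_group G" using cyclic_group a by blast
  moreover have "order G = p ^ m"
    using generate_pow_card[OF a] True ord_a by (simp add: order_def)
  ultimately show ?thesis by blast
next
  case False
  then have "even p" using odd_imp_cyclic by blast
  then have p2: "p = 2"
    using prime_odd_nat[OF p] prime_ge_2_nat[OF p] by (cases "p = 2") simp_all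
  have two: "two_group_max_cyclic G n m a"
    using p_group_max_cyclic_axioms unfolding two_group_max_cyclic_def p2 .
  obtain b where b: "b \<in> carrier G" "b \<notin> A" "b \<otimes> a = inv a \<otimes> b"
      "b \<otimes> b = a [^] ((2::nat) ^ (m - 1))" "carrier G = A \<union> (A #> b)"
    by (rule two_group_max_cyclic.cyclic_or_quaternion_relations[OF two False])
  have "ord a = 2 ^ m" "m \<ge> 1" using ord_a p2 m by simp_all
  then show ?thesis using quaternion_group_iso[OF a _ _ b] by blast
qed

theorem theorem1p1:
  fixes G :: "('a, 'b) monoid_scheme"
  assumes "group G" and "finite (carrier G)"
  shows "(\<exists>H. breaking_point G H) \<longleftrightarrow>
           ((cyclic_group G \<and> (\<exists>(p::nat) k. Factorial_Ring.prime p \<and> k \<ge> 2 \<and> order G = p ^ k))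
            \<or> (\<exists>n::nat. n \<ge> 3 \<and> G \<cong> quaternion_group n))"
    (is "?L \<longleftrightarrow> ?R")
proof
  interpret group G by fact
  assume ?L
  then obtain H where "breaking_point G H" by blast
  then obtain p n m a where G: "p_group_max_cyclic G p n m a"
    by (rule breaking_point_imp_max_cyclic[OF assms(2)])
  have "m \<ge> 2" "Factorial_Ring.prime p"
    using p_group_max_cyclic.m[OF G] p_group_max_cyclic.p[OF G] by simp_all
  moreover from \<open>m \<ge> 2\<close> have "Suc m \<ge> 3" by simp
  ultimately show ?R using p_group_max_cyclic.cyclic_or_quaternion[OF G] by blast
next
  interpret group G by fact
  assume ?R
  then show ?L
  proof
    assume "cyclic_group G \<and> (\<exists>(p::nat) k. Factorial_Ring.prime p \<and> k \<ge> 2 \<and> order G = p ^ k)"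
    then show ?L using cyclic_p_group_breaking_point[OF assms(2)] by blast
  next
    assume "\<exists>n::nat. n \<ge> 3 \<and> G \<cong> quaternion_group n"
    then show ?L using quaternion_breaking_point[OF assms(2)] by blast
  qed
qed

end
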